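(* Let $n\ge1$ be an integer. Given constants $B>0$ and $0\le\varepsilon<1$, let $$M=\left(\frac{B(1-\varepsilon)^2}{2(2\varepsilon+n(1-\varepsilon))}\right)^{\frac1{1-\varepsilon}}>0.$$ Suppose the function $u:\overline{D}_1\to\mathbb{R}$ satisfies: (i) $u$ is continuous on $\overline{D}_1$; (ii) $u(\vec x)\ge0$ for $\vec x\in D_1$; (iii) on the open set $\omega=\{\vec x\in D_1:u(\vec x)\neq0\}$, $u\in\mathcal{C}^2(\omega)$; (iv) for all $\vec x\in\omega$, $\Delta u(\vec x)-B(u(\vec x))^{\varepsilon}\ge0$. If $u(\vec0)\neq0$, then $\displaystyle\sup_{\vec x\in D_1}u(\vec x)>M$.
   Context: $D_1$ and $\overline{D}_1$ denote the open and closed unit balls in $\mathbb{R}^n$ centered at the origin $\vec0$; $\Delta$ is the Laplacian on $\mathbb{R}^n$. *)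

theory Defs
  imports "HOL-Analysis.Analysis"
begin

definition has_partial_deriv_at :: "'n::finite \<Rightarrow> (real ^ 'n \<Rightarrow> real) \<Rightarrow> real ^ 'n \<Rightarrow> bool" where
  "has_partial_deriv_at i f x \<longleftrightarrow> (\<lambda>t. f (x + t *\<^sub>R axis i 1)) differentiable (at (0::real))"

definition partial_deriv :: "'n::finite \<Rightarrow> (real ^ 'n \<Rightarrow> real) \<Rightarrow> real ^ 'n \<Rightarrow> real" where
  "partial_deriv i f x = deriv (\<lambda>t. f (x + t *\<^sub>R axis i 1)) 0"

(* C^k on an open set S: all iterated partial derivatives of order at most k exist and are
   continuous on S. For S not open the notion is not meaningful, since the partial derivatives
   are two-sided and see the values of f outside S. *)
primrec Ck_on :: "nat \<Rightarrow> (real ^ 'n::finite \<Rightarrow> real) \<Rightarrow> (real ^ 'n) set \<Rightarrow> bool" where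
  "Ck_on 0 f S \<longleftrightarrow> continuous_on S f"
| "Ck_on (Suc k) f S \<longleftrightarrow> continuous_on S f \<and>
     (\<forall>i. (\<forall>x\<in>S. has_partial_deriv_at i f x) \<and> Ck_on k (partial_deriv i f) S)"

definition laplacian :: "(real ^ 'n::finite \<Rightarrow> real) \<Rightarrow> real ^ 'n \<Rightarrow> real" where
  "laplacian f x = (\<Sum>i\<in>UNIV. partial_deriv i (partial_deriv i f) x)"

end

theory Submission
  imports Defs
begin

text \<open>
  Write \<open>q = 1 / (1 - \<epsilon>)\<close>. The function \<open>M * |x| powr (2 * q)\<close> solves the equation
  \<open>\<Delta>v = B v\<^sup>\<epsilon>\<close>, with boundary value \<open>M\<close>, but it need not be smooth at the origin. For small
  \<open>c > 0\<close> the function \<open>v x = M * (c + (1 - c) * |x|\<^sup>2) powr q\<close> is smooth and positive, is still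
  equal to \<open>M\<close> on the sphere, is a strict supersolution since \<open>\<Delta>v \<le> (1 - c) B v\<^sup>\<epsilon>\<close>, and
  satisfies \<open>v 0 = M * c powr q < u 0\<close>. If \<open>u \<le> M\<close>, then \<open>u - v\<close> attains a positive
  maximum in the open ball, and at that point \<open>\<Delta>u \<ge> B u\<^sup>\<epsilon> \<ge> B v\<^sup>\<epsilon> > \<Delta>v\<close> contradicts
  the second derivative test in the coordinate directions.
\<close>

text \<open>If \<open>d > 0\<close>, then \<open>g'\<close>, which vanishes at \<open>a\<close>, is
  positive just to the right of \<open>a\<close>, and the mean value theorem makes \<open>g\<close>
  exceed \<open>g a\<close> there. Differentiability of \<open>g'\<close> at \<open>a\<close> alone
  suffices.\<close>

lemma second_deriv_nonpos_at_local_max: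
  fixes g g' :: "real \<Rightarrow> real"
  assumes deriv: "eventually (\<lambda>t. (g has_real_derivative g' t) (at t)) (nhds a)"
    and deriv2: "(g' has_real_derivative d) (at a)"
    and max: "eventually (\<lambda>t. g t \<le> g a) (nhds a)"
  shows "d \<le> 0"
proof (rule ccontr)
  assume "\<not> d \<le> 0"
  then have "d > 0" by simp
  obtain e where e: "e > 0" "\<And>t. dist t a < e \<Longrightarrow> (g has_real_derivative g' t) (at t)"
      "\<And>t. dist t a < e \<Longrightarrow> g t \<le> g a"
    using eventually_conj[OF deriv max] unfolding eventually_nhds_metric by blast
  have "g' a = 0"
    using DERIV_local_max[OF e(2)[of a] e(1)] e(1,3) by (simp add: dist_real_def abs_minus_commute)
  moreover obtain k where k: "k > 0" "\<And>h. 0 < h \<Longrightarrow> h < k \<Longrightarrow> g' a < g' (a + h)"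
    using DERIV_pos_inc_right[OF deriv2 \<open>d > 0\<close>] by blast
  ultimately have pos: "g' t > 0" if "a < t" "t < a + k" for t
    using k(2)[of "t - a"] that by simp
  define b where "b = a + min e k / 2"
  have b: "a < b" "b < a + e" "b < a + k"
    using e(1) k(1) by (auto simp: b_def min_def)
  obtain z where z: "a < z" "z < b" "g b - g a = (b - a) * g' z"
    using MVT2[OF b(1), of g g'] e(2) b by (auto simp: dist_real_def)
  have "(b - a) * g' z > 0"
    using pos[of z] z b by simp
  moreover have "g b \<le> g a"
    using e(3)[of b] b by (simp add: dist_real_def)
  ultimately show False
    using z(3) by simp
qed

text \<open>Partial derivatives are defined at parameter 0 with a moving base point; shifting the
  parameter gives the derivative at any \<open>t\<close> along a fixed line.\<close>

lemma has_partial_deriv_at_line: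
  assumes "has_partial_deriv_at i f (x + t *\<^sub>R axis i 1)"
  shows "((\<lambda>s. f (x + s *\<^sub>R axis i 1)) has_real_derivative partial_deriv i f (x + t *\<^sub>R axis i 1)) (at t)"
proof -
  let ?h = "\<lambda>s. f (x + t *\<^sub>R axis i 1 + s *\<^sub>R axis i 1)"
  have "(?h has_real_derivative partial_deriv i f (x + t *\<^sub>R axis i 1)) (at 0)"
    using assms unfolding has_partial_deriv_at_def partial_deriv_def
    by (simp add: DERIV_deriv_iff_real_differentiable)
  also have "?h = (\<lambda>s. f (x + (s + t) *\<^sub>R axis i 1))"
    by (simp add: algebra_simps)
  finally show ?thesis
    using DERIV_shift[of "\<lambda>s. f (x + s *\<^sub>R axis i 1)" _ 0 t] by simp
qed

lemma norm_add_scaleR_axis_sq: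
  fixes x :: "real ^ 'n::finite"
  shows "(norm (x + t *\<^sub>R axis i 1))\<^sup>2 = (norm x)\<^sup>2 + 2 * t * x $ i + t\<^sup>2"
  unfolding power2_norm_eq_inner
  by (simp add: inner_add_left inner_add_right inner_axis inner_axis' power2_eq_square distrib_left)

lemma sum_nth_sq_eq_norm_sq:
  fixes x :: "real ^ 'n::finite"
  shows "(\<Sum>i\<in>UNIV. (x $ i)\<^sup>2) = (norm x)\<^sup>2"
  unfolding power2_norm_eq_inner by (simp add: inner_vec_def power2_eq_square)

text \<open>The one-variable test is applied on each coordinate line through \<open>x\<close>, and
  the results are summed. Only line derivatives of \<open>v\<close> are requested, so an explicit
  \<open>v\<close> can be handled by derivative rules.\<close>

lemma laplacian_le_at_local_max_diff:
  fixes u v :: "real ^ 'n::finite \<Rightarrow> real"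
  assumes "open S" and "x \<in> S" and "Ck_on 2 u S"
    and max: "\<And>y. y \<in> S \<Longrightarrow> u y - v y \<le> u x - v x"
    and v1: "\<And>i t. ((\<lambda>s. v (x + s *\<^sub>R axis i 1)) has_real_derivative v' i t) (at t)"
    and v2: "\<And>i. (v' i has_real_derivative v'' i) (at 0)"
  shows "laplacian u x \<le> (\<Sum>i\<in>UNIV. v'' i)"
  unfolding laplacian_def
proof (rule sum_mono)
  fix i :: 'n
  have u1: "has_partial_deriv_at i u y" and u2: "has_partial_deriv_at i (partial_deriv i u) y"
    if "y \<in> S" for y
    using \<open>Ck_on 2 u S\<close> that by (auto simp: numeral_2_eq_2)
  have "((\<lambda>t. x + t *\<^sub>R axis i 1) \<longlongrightarrow> x + 0 *\<^sub>R axis i (1::real)) (nhds (0::real))"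
    by (intro tendsto_intros filterlim_ident)
  then have ev: "eventually (\<lambda>t. x + t *\<^sub>R axis i 1 \<in> S) (nhds (0::real))"
    by (rule topological_tendstoD) (use assms in auto)
  let ?g = "\<lambda>t. u (x + t *\<^sub>R axis i 1) - v (x + t *\<^sub>R axis i 1)"
  let ?g' = "\<lambda>t. partial_deriv i u (x + t *\<^sub>R axis i 1) - v' i t"
  have "partial_deriv i (partial_deriv i u) x - v'' i \<le> 0"
  proof (rule second_deriv_nonpos_at_local_max[of ?g ?g' 0])
    show "eventually (\<lambda>t. (?g has_real_derivative ?g' t) (at t)) (nhds 0)"
      using ev by eventually_elim (intro DERIV_diff has_partial_deriv_at_line u1 v1)
    show "(?g' has_real_derivative partial_deriv i (partial_deriv i u) x - v'' i) (at 0)"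
      using has_partial_deriv_at_line[of i "partial_deriv i u" x 0] u2[OF \<open>x \<in> S\<close>]
      by (intro DERIV_diff v2) simp
    show "eventually (\<lambda>t. ?g t \<le> ?g 0) (nhds 0)"
      using ev by eventually_elim (simp add: max)
  qed
  then show "partial_deriv i (partial_deriv i u) x \<le> v'' i" by simp
qed

theorem lemma2p1:
  fixes u :: "real ^ 'n::finite \<Rightarrow> real"
    and B \<epsilon> M :: real
    and \<omega> :: "(real ^ 'n) set"
  assumes "B > 0" and "0 \<le> \<epsilon>" and "\<epsilon> < 1"
    and "M = (B * (1 - \<epsilon>)\<^sup>2 / (2 * (2 * \<epsilon> + real CARD('n) * (1 - \<epsilon>)))) powr (1 / (1 - \<epsilon>))"
    and "continuous_on (cball 0 1) u"
    and "\<forall>x\<in>ball 0 1. u x \<ge> 0"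
    and "\<omega> = {x \<in> ball 0 1. u x \<noteq> 0}"
    and "Ck_on 2 u \<omega>"
    and "\<forall>x\<in>\<omega>. laplacian u x - B * u x powr \<epsilon> \<ge> 0"
  shows "M > 0 \<and> (u 0 \<noteq> 0 \<longrightarrow> (SUP x\<in>ball 0 1. u x) > M)"
proof -
  define q where "q = 1 / (1 - \<epsilon>)"
  define n where "n = real CARD('n)"
  define K where "K = B * (1 - \<epsilon>)\<^sup>2 / (2 * (2 * \<epsilon> + n * (1 - \<epsilon>)))"
  have "q \<ge> 1" using assms(2,3) by (simp add: q_def)
  have "n > 0" by (simp add: n_def)
  have den: "2 * \<epsilon> + n * (1 - \<epsilon>) > 0"
    using assms(2,3) \<open>n > 0\<close> by (intro add_nonneg_pos) auto
  have "K > 0"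
    using assms(1,3) den by (simp add: K_def)
  have M: "M = K powr q"
    using assms(4) by (simp add: K_def q_def n_def)
  have "M > 0"
    using \<open>K > 0\<close> by (simp add: M)
  have q_eps: "q * \<epsilon> = q - 1"
    using assms(3) by (simp add: q_def field_simps)
  \<comment> \<open>The Laplacian of \<open>|x| powr (2 * q)\<close> is this coefficient times
    \<open>|x| powr (2 * q - 2)\<close>, which explains the value of \<open>K\<close>.\<close>
  have "(2 * n * q + 4 * q * (q - 1)) * K = B"
  proof -
    have "2 * n * q + 4 * q * (q - 1) = 2 * (2 * \<epsilon> + n * (1 - \<epsilon>)) / (1 - \<epsilon>)\<^sup>2"
    proof -
      define d where "d = 1 - \<epsilon>"
      have "d \<noteq> 0" "\<epsilon> = 1 - d"
        using assms(3) by (auto simp: d_def)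
      then show ?thesis
        unfolding q_def by (simp add: power2_eq_square divide_simps)
    qed
    then show ?thesis
      using den assms(3) by (simp add: K_def)
  qed
  moreover have "M = K * M powr \<epsilon>"
    unfolding M powr_powr q_eps using \<open>K > 0\<close> powr_add[of K 1 "q - 1"] by simp
  ultimately have const: "(2 * n * q + 4 * q * (q - 1)) * M = B * M powr \<epsilon>"
    by (metis mult.assoc)
  have "(SUP x\<in>ball 0 1. u x) > M" if "u 0 \<noteq> 0"
  proof (rule ccontr)
    assume "\<not> (SUP x\<in>ball 0 1. u x) > M"
    then have sup: "(SUP x\<in>ball 0 1. u x) \<le> M" by simp
    \<comment> \<open>A real \<open>SUP\<close> is known to bound the values only if the set is
      bounded above; compactness provides this.\<close>
    have "bdd_above (u ` cball 0 1)"
      by (intro bounded_imp_bdd_above compact_imp_bounded compact_continuous_image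
          assms(5) compact_cball)
    then have "bdd_above (u ` ball 0 1)"
      by (rule bdd_above_mono) auto
    then have "u x \<le> M" if "x \<in> ball 0 1" for x
      using cSUP_upper[OF that] sup by fastforce
    \<comment> \<open>Continuity carries the bound to the sphere, where it is needed to exclude a
      boundary maximum.\<close>
    then have u_le: "u x \<le> M" if "x \<in> cball 0 1" for x
      using continuous_le_on_closure[of "ball 0 1" u x M] assms(5) that by simp
    have "u 0 > 0"
      using that assms(6) by (simp add: order_less_le)
    obtain c where c: "0 < c" "c < 1" "M * c powr q < u 0"
    proof -
      \<comment> \<open>The limit is 0, since \<open>0 powr q = 0\<close>, so every small
        \<open>c > 0\<close> gives \<open>v 0 < u 0\<close>.\<close>
      have "((\<lambda>c. M * c powr q) \<longlongrightarrow> M * 0 powr q) (at_right 0)"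
        using \<open>q \<ge> 1\<close>
        by (intro tendsto_intros tendsto_powr') (auto simp: eventually_at_filter)
      then have "eventually (\<lambda>c. M * c powr q < u 0) (at_right 0)"
        using \<open>u 0 > 0\<close> by (intro order_tendstoD) auto
      moreover have "eventually (\<lambda>c. c \<in> {0<..<1::real}) (at_right 0)"
        by (rule eventually_at_right_real) simp
      ultimately have "eventually (\<lambda>c. M * c powr q < u 0 \<and> c \<in> {0<..<1}) (at_right 0)"
        by (rule eventually_conj)
      from eventually_happens'[OF _ this] show ?thesis
        using that by auto
    qed
    define s where "s x = c + (1 - c) * (norm x)\<^sup>2" for x :: "real ^ 'n"
    define v where "v x = M * s x powr q" for x
    have s_pos: "s x > 0" for x
      using c by (simp add: s_def add_pos_nonneg)
    have "continuous_on (cball 0 1) (\<lambda>x. u x - v x)"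
      unfolding v_def using s_pos
      by (intro continuous_intros assms(5)) (auto simp: s_def less_imp_neq[symmetric] intro!: continuous_intros)
    then obtain x where x: "x \<in> cball 0 1" "\<And>y. y \<in> cball 0 1 \<Longrightarrow> u y - v y \<le> u x - v x"
      using continuous_attains_sup[of "cball 0 1" "\<lambda>x. u x - v x"] by auto
    have "u 0 - v 0 > 0"
      using c by (simp add: v_def s_def)
    then have gt: "u x > v x"
      using x(2)[of 0] by simp
    have v_pos: "v x > 0"
      using \<open>M > 0\<close> s_pos[of x] by (simp add: v_def)
    have "norm x \<noteq> 1"
    proof
      assume "norm x = 1"
      then have "v x = M" by (simp add: v_def s_def)
      then show False using gt u_le[OF x(1)] by simp
    qed
    then have "x \<in> \<omega>"
      using x(1) gt v_pos assms(7) by auto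
    have "open \<omega>"
    proof -
      have "continuous_on (ball 0 1) u"
        using assms(5) by (rule continuous_on_subset) auto
      then have "open (ball 0 1 \<inter> u -` (- {0}))"
        by (intro continuous_open_preimage) auto
      also have "ball 0 1 \<inter> u -` (- {0}) = \<omega>"
        using assms(7) by auto
      finally show ?thesis .
    qed
    \<comment> \<open>First derivative of \<open>v\<close> along the line at every \<open>t\<close>;
      \<open>v''\<close> is the second one at \<open>t = 0\<close> only.\<close>
    define v' where "v' i t = 2 * M * q * (1 - c) * ((x $ i + t) * s (x + t *\<^sub>R axis i 1) powr (q - 1))" for i t
    define v'' where "v'' i = 2 * M * q * (1 - c) *
      (s x powr (q - 1) + 2 * (1 - c) * (q - 1) * (x $ i)\<^sup>2 * s x powr (q - 2))" for i
    have s_deriv: "((\<lambda>t. s (x + t *\<^sub>R axis i 1)) has_real_derivative 2 * (1 - c) * (x $ i + t)) (at t)" for i t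
      unfolding s_def norm_add_scaleR_axis_sq
      by (auto intro!: derivative_eq_intros simp: algebra_simps)
    have powr_deriv: "((\<lambda>t. s (x + t *\<^sub>R axis i 1) powr r) has_real_derivative
        r * s (x + t *\<^sub>R axis i 1) powr (r - 1) * (2 * (1 - c) * (x $ i + t))) (at t)" for i t r
      using DERIV_fun_powr[OF s_deriv s_pos] by simp
    have "laplacian u x \<le> (\<Sum>i\<in>UNIV. v'' i)"
    proof (rule laplacian_le_at_local_max_diff[OF \<open>open \<omega>\<close> \<open>x \<in> \<omega>\<close> assms(8)])
      show "u y - v y \<le> u x - v x" if "y \<in> \<omega>" for y
        using x(2) that assms(7) by auto
      show "((\<lambda>t. v (x + t *\<^sub>R axis i 1)) has_real_derivative v' i t) (at t)" for i t
        unfolding v_def v'_def by (rule derivative_eq_intros powr_deriv refl)+ (simp add: algebra_simps)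
      show "(v' i has_real_derivative v'' i) (at 0)" for i
        unfolding v'_def[abs_def] v''_def
        by (rule derivative_eq_intros powr_deriv refl)+ (simp add: algebra_simps power2_eq_square)
    qed
    also have "(\<Sum>i\<in>UNIV. v'' i) = 2 * M * q * (1 - c) *
        (n * s x powr (q - 1) + 2 * (q - 1) * ((1 - c) * (norm x)\<^sup>2) * s x powr (q - 2))"
      by (simp add: v''_def n_def sum.distrib flip: sum_distrib_left sum_distrib_right sum_nth_sq_eq_norm_sq)
        (simp add: algebra_simps)
    \<comment> \<open>Here \<open>(1 - c) * |x|\<^sup>2 \<le> s x\<close>; the factor
      \<open>q - 1\<close> is nonnegative.\<close>
    also have "\<dots> \<le> 2 * M * q * (1 - c) *
        (n * s x powr (q - 1) + 2 * (q - 1) * s x * s x powr (q - 2))"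
      using \<open>M > 0\<close> \<open>q \<ge> 1\<close> c
      by (intro mult_left_mono add_left_mono mult_right_mono) (auto simp: s_def)
    \<comment> \<open>This identity is not a link of the chain; it only feeds the next equality,
      which is.\<close>
    also have "s x powr (q - 1) = s x * s x powr (q - 2)"
      using s_pos[of x] powr_add[of "s x" 1 "q - 2"] by simp
    then have "2 * M * q * (1 - c) * (n * s x powr (q - 1) + 2 * (q - 1) * s x * s x powr (q - 2))
        = (1 - c) * ((2 * n * q + 4 * q * (q - 1)) * M * s x powr (q - 1))"
      by (simp add: algebra_simps)
    \<comment> \<open>By \<open>q * \<epsilon> = q - 1\<close>, \<open>v x powr \<epsilon>\<close>
      equals \<open>M powr \<epsilon> * s x powr (q - 1)\<close>. The factor
      \<open>1 - c < 1\<close> then yields the strict inequality.\<close>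
    also have "\<dots> = (1 - c) * (B * v x powr \<epsilon>)"
      using \<open>M > 0\<close> s_pos[of x] by (simp add: const v_def powr_mult powr_powr q_eps)
    also have "\<dots> < B * v x powr \<epsilon>"
      using assms(1) v_pos c by simp
    also have "\<dots> \<le> B * u x powr \<epsilon>"
      using assms(1,2) v_pos gt by (intro mult_left_mono powr_mono2) auto
    also have "\<dots> \<le> laplacian u x"
      using assms(9) \<open>x \<in> \<omega>\<close> by auto
    finally show False by simp
  qed
  with \<open>M > 0\<close> show ?thesis by simp
qed

end
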